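(* There is a universal constant $C>0$ such that for every integer $d\ge 2$ and every $b\in\mathbb{R}^d$, the Sorting Algorithm (described in the context) on input $(d,b)$ outputs the optimal solution of $$\min_{x\in\mathbb{R}^d}\ \tfrac12 x^\top Q_d x+b^\top x\quad\text{subject to } x\le \mathbf{0}_d$$ using at most $C\,d\log d$ time; i.e. the algorithm solves this problem in $O(d\log d)$ time.
   Context: For $m\ge1$, $Q_m:=2\mathrm{I}_m+2\mathrm{J}_m$, where $\mathrm{I}_m$ is the identity matrix and $\mathrm{J}_m$ is the $m\times m$ all-ones matrix; $Q_m^{-1}=\frac12\left(\mathrm{I}_m-\frac1{1+m}\mathrm{J}_m\right)$, and products $Q_m^{-1}v$ are evaluated with this formula. Vector inequalities are entrywise. For $F\subseteq\{1,\dots,d\}$, $b_F\in\mathbb{R}^{|F|}$ is the subvector of $b$ with indices in $F$, and vectors in $\mathbb{R}^{|F|}$ are indexed by $F$; if $F=\emptyset$ then $-Q_{|F|}^{-1}b_F$ is the empty vector. Time is the number of elementary operations (real arithmetic operations, comparisons, assignments), each of unit cost; sorting is done by a standard comparison sort taking $O(d\log d)$ operations. Sorting Algorithm (input $d,b$): 1. Set $S:=0$, $F:=\emptyset$, $x^\ast:=\mathbf{0}_d$; compute a permutation $I=(I_1,\dots,I_d)$ of $\{1,\dots,d\}$ with $b_{I_1}\ge b_{I_2}\ge\dots\ge b_{I_d}$. 2. For $i=1,\dots,d$: replace $S$ by $S+b_{I_i}$; if $b_{I_i}<S/(i+1)$, exit the for loop; otherwise replace $F$ by $F\cup\{I_i\}$.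 3. Set $x^\ast_F:=-Q_{|F|}^{-1}b_F$ and output $x^\ast$ (the other entries remain $0$). *)

theory Defs
  imports Complex_Main "HOL-Library.Monad_Syntax" "Jordan_Normal_Form.Matrix"
begin

section \<open>The optimization problem\<close>

text \<open>Indices run over \<open>0, \<dots>, d - 1\<close> instead of \<open>1, \<dots>, d\<close>.\<close>

definition J_mat :: "nat \<Rightarrow> real mat" where
  "J_mat m = mat m m (\<lambda>_. 1)"

definition Q_mat :: "nat \<Rightarrow> real mat" where
  "Q_mat m = 2 \<cdot>\<^sub>m 1\<^sub>m m + 2 \<cdot>\<^sub>m J_mat m"

definition Q_inv :: "nat \<Rightarrow> real mat" where
  "Q_inv m = (1/2) \<cdot>\<^sub>m (1\<^sub>m m - (1 / (1 + real m)) \<cdot>\<^sub>m J_mat m)"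

definition objective :: "nat \<Rightarrow> real vec \<Rightarrow> real vec \<Rightarrow> real" where
  "objective d b x = 1/2 * (x \<bullet> (Q_mat d *\<^sub>v x)) + b \<bullet> x"

definition feasible :: "nat \<Rightarrow> real vec \<Rightarrow> bool" where
  "feasible d x \<longleftrightarrow> x \<in> carrier_vec d \<and> x \<le> 0\<^sub>v d"

definition optimal_solutions :: "nat \<Rightarrow> real vec \<Rightarrow> real vec set" where
  "optimal_solutions d b = {x. is_arg_min (objective d b) (feasible d) x}"


section \<open>Computations with an operation count\<close>

datatype 'a tm = TM (val: 'a) (cost: nat)

definition bind_tm :: "'a tm \<Rightarrow> ('a \<Rightarrow> 'b tm) \<Rightarrow> 'b tm" where
  "bind_tm m f = TM (val (f (val m))) (cost m + cost (f (val m)))"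

adhoc_overloading Monad_Syntax.bind \<rightleftharpoons> bind_tm

lemma bind_tm_cong [fundef_cong]:
  "m = m' \<Longrightarrow> (\<And>x. x = val m' \<Longrightarrow> f x = g x) \<Longrightarrow> bind_tm m f = bind_tm m' g"
  by (simp add: bind_tm_def)

lemma val_bind_tm [simp]: "val (bind_tm m f) = val (f (val m))"
  and cost_bind_tm [simp]: "cost (bind_tm m f) = cost m + cost (f (val m))"
  by (simp_all add: bind_tm_def)

text \<open>
  The argument of \<open>compute\<close> is always a single arithmetic operation or comparison; it is charged
  together with the assignment of its result. The argument of \<open>copy\<close> is a value that is only
  assigned: a variable, an array entry, an array after writing one entry, or a list extended by
  one cell. \<open>step\<close> is the comparison that decides whether the end of a list has been reached.
\<close>

definition compute :: "'a \<Rightarrow> 'a tm" where "compute v = TM v 2"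
definition copy :: "'a \<Rightarrow> 'a tm" where "copy v = TM v 1"
definition step :: "unit tm" where "step = TM () 1"

text \<open>
  Filling an array of length \<open>d\<close> in a counting loop: each round performs a comparison, an
  assignment, and an increment of the counter together with its assignment; one more comparison
  ends the loop.
\<close>

definition fill :: "nat \<Rightarrow> 'a \<Rightarrow> 'a tm" where "fill d v = TM v (4 * d + 1)"

fun map_tm :: "('a \<Rightarrow> 'b tm) \<Rightarrow> 'a list \<Rightarrow> 'b list tm" where
  "map_tm f [] = do { step; copy [] }"
| "map_tm f (x # xs) = do { step; y \<leftarrow> f x; ys \<leftarrow> map_tm f xs; copy (y # ys) }"

fun sum_tm :: "real list \<Rightarrow> real tm" where
  "sum_tm [] = do { step; copy 0 }"
| "sum_tm (x # xs) = do { step; s \<leftarrow> sum_tm xs; compute (x + s) }"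

fun count_tm :: "'a list \<Rightarrow> real tm" where
  "count_tm [] = do { step; copy 0 }"
| "count_tm (x # xs) = do { step; n \<leftarrow> count_tm xs; compute (1 + n) }"


section \<open>Sorting the indices\<close>

text \<open>
  Merge sort into nonincreasing order of \<open>b\<close>. The order among indices with equal entries of \<open>b\<close>
  is left open: it is decided by an arbitrary relation \<open>tie\<close>.
\<close>

definition before :: "(nat \<Rightarrow> nat \<Rightarrow> bool) \<Rightarrow> real vec \<Rightarrow> nat \<Rightarrow> nat \<Rightarrow> bool tm" where
  "before tie b i j = do {
     x \<leftarrow> copy (b $ i);
     y \<leftarrow> copy (b $ j);
     greater \<leftarrow> compute (x > y);
     if greater then copy True
     else do {
       equal \<leftarrow> compute (x = y);
       if equal then compute (tie i j) else copy False
     }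
   }"

fun split :: "'a list \<Rightarrow> ('a list \<times> 'a list) tm" where
  "split [] = do { step; copy ([], []) }"
| "split (x # xs) = do {
     step;
     (ys, zs) \<leftarrow> split xs;
     zs' \<leftarrow> copy (x # zs);
     copy (zs', ys)
   }"

fun merge :: "('a \<Rightarrow> 'a \<Rightarrow> bool tm) \<Rightarrow> 'a list \<Rightarrow> 'a list \<Rightarrow> 'a list tm" where
  "merge r [] ys = do { step; copy ys }"
| "merge r (x # xs) [] = do { step; step; copy (x # xs) }"
| "merge r (x # xs) (y # ys) = do {
     step; step;
     first \<leftarrow> r x y;
     if first then do { zs \<leftarrow> merge r xs (y # ys); copy (x # zs) }
     else do { zs \<leftarrow> merge r (x # xs) ys; copy (y # zs) }
   }"

lemma length_split:
  "length (fst (val (split xs))) = (length xs + 1) div 2 \<and>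
   length (snd (val (split xs))) = length xs div 2"
  by (induction xs) (auto simp: copy_def split: prod.splits)

function merge_sort :: "('a \<Rightarrow> 'a \<Rightarrow> bool tm) \<Rightarrow> 'a list \<Rightarrow> 'a list tm" where
  "merge_sort r [] = do { step; copy [] }"
| "merge_sort r [x] = do { step; step; copy [x] }"
| "merge_sort r (x # y # zs) = do {
     step; step;
     (us, vs) \<leftarrow> split (x # y # zs);
     us' \<leftarrow> merge_sort r us;
     vs' \<leftarrow> merge_sort r vs;
     merge r us' vs'
   }"
  by pat_completeness auto
termination
proof (relation "measure (\<lambda>(r, xs). length xs)", goal_cases)
  case 1
  then show ?case by simp
next
  case (2 r x y zs u uu p us vs)
  then have "val (split (x # y # zs)) = (us, vs)" by simp
  then show ?case
    using length_split[of "x # y # zs"] by (simp del: split.simps)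
next
  case (3 r x y zs u uu p us vs w)
  then have "val (split (x # y # zs)) = (us, vs)" by simp
  then show ?case
    using length_split[of "x # y # zs"] by (simp del: split.simps)
qed


section \<open>The Sorting Algorithm\<close>

text \<open>
  The for loop; \<open>js\<close> are the indices of the permutation still to be processed, \<open>i\<close> is the
  number of the current round (starting with 1), and \<open>F\<close> is a list of its distinct elements.
\<close>

fun sort_loop :: "real vec \<Rightarrow> nat list \<Rightarrow> real \<Rightarrow> real \<Rightarrow> nat list \<Rightarrow> nat list tm" where
  "sort_loop b [] i S F = do { step; copy F }"
| "sort_loop b (j # js) i S F = do {
     step;
     bj \<leftarrow> copy (b $ j);
     S' \<leftarrow> compute (S + bj);
     i' \<leftarrow> compute (i + 1);
     q \<leftarrow> compute (S' / i');
     stop \<leftarrow> compute (bj < q);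
     if stop then copy F
     else do { F' \<leftarrow> copy (j # F); sort_loop b js i' S' F' }
   }"

definition Q_inv_mult :: "real list \<Rightarrow> real list tm" where
  "Q_inv_mult v = do {
     s \<leftarrow> sum_tm v;
     m \<leftarrow> count_tm v;
     m' \<leftarrow> compute (1 + m);
     r \<leftarrow> compute (1 / m');
     c \<leftarrow> compute (r * s);
     map_tm (\<lambda>x. do { y \<leftarrow> compute (x - c); compute (y / 2) }) v
   }"

fun write_entries :: "nat list \<Rightarrow> real list \<Rightarrow> real vec \<Rightarrow> real vec tm" where
  "write_entries (j # js) (w # ws) x =
     do { step; x' \<leftarrow> copy (x |\<^sub>v j \<mapsto> w); write_entries js ws x' }"
| "write_entries _ _ x = do { step; copy x }"

definition sorting_algorithm ::
    "(nat \<Rightarrow> nat \<Rightarrow> bool) \<Rightarrow> nat \<Rightarrow> real vec \<Rightarrow> real vec tm" where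
  "sorting_algorithm tie d b = do {
     S \<leftarrow> copy 0;
     F \<leftarrow> copy [];
     x \<leftarrow> fill d (0\<^sub>v d);
     is \<leftarrow> fill d [0..<d];
     I \<leftarrow> merge_sort (before tie b) is;
     i \<leftarrow> copy 1;
     F' \<leftarrow> sort_loop b I i S F;
     bF \<leftarrow> map_tm (\<lambda>j. copy (b $ j)) F';
     w \<leftarrow> Q_inv_mult bF;
     xF \<leftarrow> map_tm (\<lambda>y. compute (- y)) w;
     write_entries F' xF x
   }"

lemma val_map_tm: "val (map_tm f xs) = map (\<lambda>x. val (f x)) xs"
  by (induction xs) (auto simp: copy_def)

lemma val_sum_tm: "val (sum_tm xs) = sum_list xs"
  by (induction xs) (auto simp: copy_def compute_def)

lemma val_count_tm: "val (count_tm xs) = real (length xs)"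
  by (induction xs) (auto simp: copy_def compute_def)

lemma val_Q_inv_mult:
  "vec_of_list (val (Q_inv_mult v)) = Q_inv (length v) *\<^sub>v vec_of_list v"
proof (intro eq_vecI)
  let ?m = "length v"
  let ?a = "1 / (1 + real ?m)"
  fix i assume "i < dim_vec (Q_inv ?m *\<^sub>v vec_of_list v)"
  then have i: "i < ?m" by (simp add: Q_inv_def J_mat_def)
  have "(Q_inv ?m *\<^sub>v vec_of_list v) $ i =
      (\<Sum>k\<in>{0..<?m}. (1/2 * ((if i = k then 1 else 0) - ?a)) * v ! k)"
    using i by (auto simp: Q_inv_def J_mat_def scalar_prod_def vec_of_list_index intro!: sum.cong)
  also have "\<dots> = (\<Sum>k\<in>{0..<?m}. (if k = i then v ! i / 2 else 0) - ?a * v ! k / 2)"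
    by (intro sum.cong) (auto simp: field_simps)
  also have "\<dots> = v ! i / 2 - ?a * sum_list v / 2"
    using i by (simp add: sum_subtractf sum_list_sum_nth sum_distrib_left sum_divide_distrib)
  also have "\<dots> = vec_of_list (val (Q_inv_mult v)) $ i"
    using i by (simp add: Q_inv_mult_def val_map_tm val_sum_tm val_count_tm compute_def
        vec_of_list_index diff_divide_distrib)
  finally show "vec_of_list (val (Q_inv_mult v)) $ i = (Q_inv ?m *\<^sub>v vec_of_list v) $ i" ..
qed (simp add: Q_inv_mult_def val_map_tm Q_inv_def J_mat_def)

lemma Q_mat_mult_Q_inv: "Q_mat m * Q_inv m = 1\<^sub>m m"
proof (intro eq_matI)
  fix i j assume "i < dim_row (1\<^sub>m m :: real mat)" and "j < dim_col (1\<^sub>m m :: real mat)"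
  then have ij: "i < m" "j < m" by auto
  let ?a = "1 / (1 + real m)"
  let ?e = "\<lambda>i j. if i = j then 1 else (0 :: real)"
  have "(Q_mat m * Q_inv m) $$ (i, j) =
      (\<Sum>k\<in>{0..<m}. (2 * ?e i k + 2) * (1/2 * (?e k j - ?a)))"
    using ij by (auto simp: Q_mat_def Q_inv_def J_mat_def scalar_prod_def intro!: sum.cong)
  also have "\<dots> = (\<Sum>k\<in>{0..<m}. (if k = i then ?e i j - ?a else 0) + (if k = j then 1 else 0) - ?a)"
    by (intro sum.cong) auto
  also have "\<dots> = ?e i j + 1 - (?a + real m * ?a)"
    using ij by (simp add: sum.distrib sum_subtractf)
  also have "?a + real m * ?a = 1"
    by (simp add: add_divide_distrib[symmetric] add_nonneg_eq_0_iff)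
  also have "?e i j + 1 - 1 = ?e i j"
    by simp
  finally show "(Q_mat m * Q_inv m) $$ (i, j) = 1\<^sub>m m $$ (i, j)"
    using ij by simp
qed (auto simp: Q_mat_def Q_inv_def J_mat_def)

lemma val_before: "val (before tie b i j) \<longleftrightarrow> b $ i > b $ j \<or> b $ i = b $ j \<and> tie i j"
  by (auto simp: before_def copy_def compute_def)

lemma mset_split: "mset (fst (val (split xs))) + mset (snd (val (split xs))) = mset xs"
  by (induction xs) (auto simp: copy_def add.commute split: prod.splits)

lemma mset_merge: "mset (val (merge r xs ys)) = mset xs + mset ys"
  by (induction r xs ys rule: merge.induct) (auto simp: copy_def)

lemma mset_merge_sort: "mset (val (merge_sort r xs)) = mset xs"
proof (induction r xs rule: merge_sort.induct)
  case (3 r x y zs)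
  then show ?case
    using mset_split[of "x # y # zs"]
    by (cases "val (split (x # y # zs))") (simp del: split.simps add: mset_merge)
qed (auto simp: copy_def)

lemma sorted_merge:
  assumes "\<And>x y. val (r x y) \<Longrightarrow> P x y" and "\<And>x y. \<not> val (r x y) \<Longrightarrow> P y x" and "transp P"
    and "sorted_wrt P xs" and "sorted_wrt P ys"
  shows "sorted_wrt P (val (merge r xs ys))"
  using assms
proof (induction r xs ys rule: merge.induct)
  case (3 r x xs y ys)
  have set: "set (val (merge r us vs)) = set us \<union> set vs" for us vs
    using mset_merge[of r us vs] by (metis set_mset_mset set_mset_union)
  note trans = transpD[OF 3(5)]
  show ?case
  proof (cases "val (r x y)")
    case True
    then have "P x y" by (rule 3(3))
    then have "\<forall>z\<in>set (y # ys). P x z"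
      using 3(7) trans by auto
    moreover have "sorted_wrt P (val (merge r xs (y # ys)))"
      using 3(6) by (intro 3(1)[OF refl refl refl True 3(3) 3(4) 3(5) _ 3(7)]) simp_all
    ultimately show ?thesis using True 3(6) by (auto simp: copy_def set)
  next
    case False
    then have "P y x" by (rule 3(4))
    then have "\<forall>z\<in>set (x # xs). P y z"
      using 3(6) trans by auto
    moreover have "sorted_wrt P (val (merge r (x # xs) ys))"
      using 3(7) by (intro 3(2)[OF refl refl refl False 3(3) 3(4) 3(5) 3(6)]) simp_all
    ultimately show ?thesis using False 3(7) by (auto simp: copy_def set)
  qed
qed (auto simp: copy_def)

lemma sorted_merge_sort:
  assumes "\<And>x y. val (r x y) \<Longrightarrow> P x y" and "\<And>x y. \<not> val (r x y) \<Longrightarrow> P y x" and "transp P"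
  shows "sorted_wrt P (val (merge_sort r xs))"
  using assms
proof (induction r xs rule: merge_sort.induct)
  case (3 r x y zs)
  obtain us vs where s: "val (split (x # y # zs)) = (us, vs)" by fastforce
  have "sorted_wrt P (val (merge_sort r us))"
    by (rule 3(1)[OF refl refl s[symmetric] refl 3(3) 3(4) 3(5)])
  moreover have "sorted_wrt P (val (merge_sort r vs))"
    by (rule 3(2)[OF refl refl s[symmetric] refl refl 3(3) 3(4) 3(5)])
  ultimately have "sorted_wrt P (val (merge r (val (merge_sort r us)) (val (merge_sort r vs))))"
    using 3(3-5) by (intro sorted_merge)
  then show ?case
    using s by (simp del: split.simps)
qed (auto simp: copy_def)

text \<open>
  Whatever \<open>tie\<close> is, the indices are sorted correctly, and every permutation admitted by the
  Sorting Algorithm is obtained for some \<open>tie\<close>.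
\<close>

lemma merge_sort_before:
  fixes tie :: "nat \<Rightarrow> nat \<Rightarrow> bool" and b :: "real vec" and d :: nat
  defines "I \<equiv> val (merge_sort (before tie b) [0..<d])"
  shows "mset I = mset [0..<d]" and "sorted_wrt (\<lambda>i j. b $ i \<ge> b $ j) I"
proof -
  show "mset I = mset [0..<d]"
    unfolding I_def by (rule mset_merge_sort)
  show "sorted_wrt (\<lambda>i j. b $ i \<ge> b $ j) I"
    unfolding I_def by (rule sorted_merge_sort) (auto simp: val_before transp_def)
qed

lemma sorted_wrt_mset_unique:
  assumes "mset xs = mset ys" and "sorted_wrt P xs" and "sorted_wrt P ys"
    and "\<And>x y. x \<in> set xs \<Longrightarrow> y \<in> set xs \<Longrightarrow> P x y \<Longrightarrow> P y x \<Longrightarrow> x = y"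
  shows "xs = ys"
  using assms
proof (induction xs arbitrary: ys)
  case (Cons x xs)
  obtain y ys' where ys: "ys = y # ys'"
    using Cons.prems(1) by (cases ys) auto
  have set: "set (x # xs) = set (y # ys')"
    using Cons.prems(1) ys by (metis set_mset_mset)
  have "x = y"
  proof (rule ccontr)
    assume "x \<noteq> y"
    then have "x \<in> set ys'" "y \<in> set xs" using set by auto
    then have "P x y" "P y x" using Cons.prems(2,3) ys by auto
    then show False using Cons.prems(4) \<open>x \<noteq> y\<close> \<open>y \<in> set xs\<close> by auto
  qed
  moreover have "xs = ys'"
    using Cons.prems ys \<open>x = y\<close> by (intro Cons.IH) auto
  ultimately show ?case using ys by simp
qed auto

lemma ex_tie:
  assumes I: "mset I = mset [0..<d]" "sorted_wrt (\<lambda>i j. b $ i \<ge> b $ j) I"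
  shows "\<exists>tie. val (merge_sort (before tie b) [0..<d]) = I"
proof -
  have dist: "distinct I"
    using I(1) by (metis distinct_upt mset_eq_imp_distinct_iff)
  define pos where "pos i = (THE k. k < length I \<and> I ! k = i)" for i
  have pos: "pos (I ! k) = k" if "k < length I" for k
    unfolding pos_def using that dist by (auto simp: nth_eq_iff_index_eq)
  define P where "P i j \<longleftrightarrow> b $ i > b $ j \<or> b $ i = b $ j \<and> pos i \<le> pos j" for i j
  let ?I' = "val (merge_sort (before (\<lambda>i j. pos i \<le> pos j) b) [0..<d])"
  have "sorted_wrt P ?I'"
    by (rule sorted_merge_sort) (auto simp: val_before P_def transp_def)
  moreover have "sorted_wrt P I"
    unfolding sorted_wrt_iff_nth_less
  proof (intro allI impI)
    fix k l assume kl: "k < l" "l < length I"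
    then have "b $ (I ! k) \<ge> b $ (I ! l)"
      using I(2) by (simp add: sorted_wrt_iff_nth_less)
    then show "P (I ! k) (I ! l)" using kl pos unfolding P_def by auto
  qed
  moreover have m: "mset ?I' = mset I"
    using I(1) by (simp add: mset_merge_sort)
  moreover have "i = j" if "P i j" "P j i" "i \<in> set ?I'" "j \<in> set ?I'" for i j
  proof -
    have "i \<in> set I" "j \<in> set I" using that m by (metis set_mset_mset)+
    then obtain k l where "k < length I" "I ! k = i" "l < length I" "I ! l = j"
      by (auto simp: in_set_conv_nth)
    moreover have "pos i = pos j" using that(1,2) unfolding P_def by auto
    ultimately show ?thesis using pos by metis
  qed
  ultimately have "?I' = I" by (intro sorted_wrt_mset_unique[where P = P])
  then show ?thesis by blast
qed

end

theory Submission
  imports Defs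
begin

text \<open>
  The objective is \<open>\<Sum>x\<^sub>i\<^sup>2 + (\<Sum>x\<^sub>i)\<^sup>2 + \<Sum>b\<^sub>i x\<^sub>i\<close>, a strictly convex function, so a point
  satisfying the KKT conditions is the unique minimizer. On a support \<open>F\<close> the stationarity
  equations are solved by \<open>x\<^sub>j = (c - b\<^sub>j) / 2\<close> with \<open>c = (\<Sum>j\<in>F. b\<^sub>j) / (1 + |F|)\<close>, and the KKT
  conditions then say that \<open>F\<close> separates the entries \<open>b\<^sub>j \<ge> c\<close> from the entries \<open>b\<^sub>j \<le> c\<close>.
  The loop stops exactly at such a prefix of the sorted indices, because
  \<open>b < (S + b) / (k + 2)\<close> is equivalent to \<open>b < S / (k + 1)\<close>.
\<close>

section \<open>Optimality\<close>

lemma objective_eq: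
  assumes "b \<in> carrier_vec d" "x \<in> carrier_vec d"
  shows "objective d b x = (\<Sum>i<d. (x $ i)\<^sup>2) + (\<Sum>i<d. x $ i)\<^sup>2 + (\<Sum>i<d. b $ i * x $ i)"
proof -
  have row: "(Q_mat d *\<^sub>v x) $ i = 2 * x $ i + 2 * (\<Sum>k<d. x $ k)" if "i < d" for i
  proof -
    have "(Q_mat d *\<^sub>v x) $ i = (\<Sum>k<d. (2 * (if i = k then 1 else 0) + 2) * x $ k)"
      using that assms
      by (auto simp: Q_mat_def J_mat_def scalar_prod_def atLeast0LessThan intro!: sum.cong)
    also have "\<dots> = (\<Sum>k<d. (if k = i then 2 * x $ i else 0) + 2 * x $ k)"
      by (intro sum.cong) auto
    finally show ?thesis
      using that by (simp add: sum.distrib sum_distrib_left)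
  qed
  have "dim_vec (Q_mat d *\<^sub>v x) = d"
    by (simp add: Q_mat_def J_mat_def)
  then have "x \<bullet> (Q_mat d *\<^sub>v x) = (\<Sum>i<d. x $ i * (2 * x $ i + 2 * (\<Sum>k<d. x $ k)))"
    using row by (simp add: scalar_prod_def atLeast0LessThan)
  also have "\<dots> = (\<Sum>i<d. 2 * (x $ i)\<^sup>2 + (x $ i) * (2 * (\<Sum>k<d. x $ k)))"
    by (simp add: algebra_simps power2_eq_square)
  also have "\<dots> = 2 * (\<Sum>i<d. (x $ i)\<^sup>2) + (\<Sum>i<d. x $ i) * (2 * (\<Sum>k<d. x $ k))"
    by (simp only: sum.distrib sum_distrib_left[symmetric] sum_distrib_right[symmetric])
  finally show ?thesis
    using assms by (simp add: objective_def scalar_prod_def atLeast0LessThan power2_eq_square)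
qed

text \<open>\<open>g\<close> is the gradient of the objective at \<open>x\<close>. The objective is
  quadratic, so its increase from \<open>x\<close> to \<open>y\<close> is exactly the linear term in
  \<open>g\<close> plus two squares. Keeping one of them gives \<open>growth\<close>, which yields
  both minimality and uniqueness.\<close>

lemma optimal_solutions_KKT:
  fixes d :: nat and b x :: "real vec"
  defines "g \<equiv> \<lambda>i. 2 * x $ i + 2 * (\<Sum>k<d. x $ k) + b $ i"
  assumes b: "b \<in> carrier_vec d" and x: "feasible d x"
    and nonpos: "\<And>i. i < d \<Longrightarrow> g i \<le> 0"
    and slack: "\<And>i. i < d \<Longrightarrow> x $ i = 0 \<or> g i = 0"
  shows "optimal_solutions d b = {x}"
proof -
  have growth: "objective d b x + (\<Sum>i<d. (y $ i - x $ i)\<^sup>2) \<le> objective d b y"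
    if y: "feasible d y" for y
  proof -
    have "0 \<le> (\<Sum>i<d. g i * (y $ i - x $ i))"
    proof (intro sum_nonneg)
      fix i assume "i \<in> {..<d}"
      then have i: "i < d" by simp
      have "y $ i \<le> 0"
        using y i by (auto simp: feasible_def less_eq_vec_def)
      \<comment> \<open>If \<open>x $ i = 0\<close>, this is a product of two nonpositive numbers;
        otherwise \<open>g i = 0\<close>.\<close>
      then show "0 \<le> g i * (y $ i - x $ i)"
        using slack[OF i] nonpos[OF i] by (auto simp: mult_nonpos_nonpos)
    qed
    \<comment> \<open>Termwise, \<open>2 * x * (y - x)\<close> equals
      \<open>y\<^sup>2 - x\<^sup>2 - (y - x)\<^sup>2\<close>.\<close>
    moreover have "(\<Sum>i<d. g i * (y $ i - x $ i)) =
        (\<Sum>i<d. (y $ i)\<^sup>2) - (\<Sum>i<d. (x $ i)\<^sup>2) - (\<Sum>i<d. (y $ i - x $ i)\<^sup>2)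
        + 2 * (\<Sum>k<d. x $ k) * ((\<Sum>i<d. y $ i) - (\<Sum>i<d. x $ i))
        + ((\<Sum>i<d. b $ i * y $ i) - (\<Sum>i<d. b $ i * x $ i))"
      unfolding g_def sum_distrib_left[of "2 * _"] sum_subtractf[symmetric] sum.distrib[symmetric]
      by (intro sum.cong) (auto simp: algebra_simps power2_eq_square)
    moreover have "0 \<le> ((\<Sum>i<d. y $ i) - (\<Sum>i<d. x $ i))\<^sup>2"
      by simp
    ultimately show ?thesis
      using b x y unfolding feasible_def
      by (simp add: objective_eq power2_eq_square algebra_simps)
  qed
  have "objective d b x \<le> objective d b y" if "feasible d y" for y
    using growth[OF that] sum_nonneg[of "{..<d}" "\<lambda>i. (y $ i - x $ i)\<^sup>2"] by simp
  then have "x \<in> optimal_solutions d b"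
    using x by (auto simp: optimal_solutions_def is_arg_min_linorder)
  moreover have "y = x" if "y \<in> optimal_solutions d b" for y
  proof -
    have y: "feasible d y" "objective d b y \<le> objective d b x"
      using that x by (auto simp: optimal_solutions_def is_arg_min_linorder)
    have "(\<Sum>i<d. (y $ i - x $ i)\<^sup>2) \<le> 0"
      using growth[OF y(1)] y(2) by simp
    then have "(\<Sum>i<d. (y $ i - x $ i)\<^sup>2) = 0"
      by (intro antisym sum_nonneg) auto
    then have "\<forall>i<d. y $ i = x $ i"
      by (simp add: sum_nonneg_eq_0_iff)
    then show ?thesis
      using x y(1) by (intro eq_vecI) (auto simp: feasible_def)
  qed
  ultimately show ?thesis by blast
qed

text \<open>The choice of \<open>c\<close> makes the entries of the candidate sum to
  \<open>- c / 2\<close>. Its gradient is therefore 0 on \<open>F\<close> and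
  \<open>b $ j - c\<close> off \<open>F\<close>; \<open>above\<close> gives feasibility and
  \<open>below\<close> the sign of the gradient.\<close>

lemma optimal_solutions_threshold:
  fixes d :: nat and b :: "real vec" and F :: "nat set"
  defines "c \<equiv> (\<Sum>j\<in>F. b $ j) / (1 + real (card F))"
  assumes b: "b \<in> carrier_vec d" and F: "F \<subseteq> {..<d}"
    and above: "\<And>j. j \<in> F \<Longrightarrow> c \<le> b $ j"
    and below: "\<And>j. j < d \<Longrightarrow> j \<notin> F \<Longrightarrow> b $ j \<le> c"
  shows "optimal_solutions d b = {vec d (\<lambda>j. if j \<in> F then (c - b $ j) / 2 else 0)}"
    (is "_ = {?x}")
proof -
  have "(\<Sum>j<d. ?x $ j) = (\<Sum>j<d. if j \<in> F then (c - b $ j) / 2 else 0)"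
    by simp
  also have "\<dots> = (\<Sum>j\<in>F. (c - b $ j) / 2)"
    using F by (simp add: sum.If_cases Int_absorb1)
  also have "\<dots> = (real (card F) * c - (\<Sum>j\<in>F. b $ j)) / 2"
    by (simp add: sum_subtractf flip: sum_divide_distrib)
  also have "(\<Sum>j\<in>F. b $ j) = c * (1 + real (card F))"
    unfolding c_def by (simp add: add_nonneg_eq_0_iff)
  finally have "(\<Sum>j<d. ?x $ j) = - c / 2"
    by (simp add: algebra_simps)
  then show ?thesis
    using b above below
    by (intro optimal_solutions_KKT) (auto simp: feasible_def less_eq_vec_def diff_divide_distrib)
qed

section \<open>Correctness of the algorithm\<close>

text \<open>Stated for an arbitrary loop state so that the induction goes through; \<open>k\<close>
  counts the accepted indices. Only the last accepted and the first rejected entry are compared with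
  \<open>c\<close>; sortedness later extends the bounds to all entries.\<close>

lemma val_sort_loop:
  assumes "i > 0"
  shows "\<exists>k\<le>length js. val (sort_loop b js i S F) = rev (take k js) @ F \<and>
    (let c = (S + (\<Sum>j\<leftarrow>take k js. b $ j)) / (i + real k) in
      (k > 0 \<longrightarrow> c \<le> b $ (js ! (k - 1))) \<and> (k < length js \<longrightarrow> b $ (js ! k) \<le> c))"
  using assms
proof (induction js arbitrary: i S F)
  case Nil
  then show ?case by (simp add: copy_def)
next
  case (Cons j js)
  show ?case
  proof (cases "b $ j < (S + b $ j) / (i + 1)")
    case True
    then have "b $ j \<le> S / i"
      using Cons.prems by (simp add: field_simps)
    then show ?thesis
      using True by (intro exI[of _ 0]) (simp add: copy_def compute_def)
  next
    case False
    obtain k where k: "k \<le> length js"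
      "val (sort_loop b js (i + 1) (S + b $ j) (j # F)) = rev (take k js) @ j # F"
      "let c = (S + b $ j + (\<Sum>j\<leftarrow>take k js. b $ j)) / (i + 1 + real k) in
        (k > 0 \<longrightarrow> c \<le> b $ (js ! (k - 1))) \<and> (k < length js \<longrightarrow> b $ (js ! k) \<le> c)"
      using Cons.IH[of "i + 1" "S + b $ j" "j # F"] Cons.prems by auto
    show ?thesis
      \<comment> \<open>For \<open>k = 0\<close> the last accepted index is \<open>j\<close> itself,
        and the failed stopping test is the bound wanted; for larger \<open>k\<close> the bound
        comes from the induction hypothesis.\<close>
      using k False
      by (intro exI[of _ "Suc k"])
        (cases k; auto simp: copy_def compute_def Let_def add_ac not_less)
  qed
qed

lemma val_write_entries:
  assumes "distinct js" "set js \<subseteq> {..<dim_vec x}"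
  shows "val (write_entries js (map h js) x) =
    vec (dim_vec x) (\<lambda>j. if j \<in> set js then h j else x $ j)"
  using assms
proof (induction js arbitrary: x)
  case (Cons j js)
  then show ?case by (auto simp: copy_def)
qed (auto simp: copy_def)

lemma val_sorting_algorithm:
  assumes "b \<in> carrier_vec d"
  shows "optimal_solutions d b = {val (sorting_algorithm tie d b)}"
proof -
  define I where "I = val (merge_sort (before tie b) [0..<d])"
  note I = merge_sort_before[where tie = tie and b = b and d = d, folded I_def]
  have set_I: "set I = {..<d}"
    using arg_cong[OF I(1), of set_mset] by (simp add: atLeast0LessThan)
  have dist: "distinct I"
    using I(1) by (metis distinct_upt mset_eq_imp_distinct_iff)
  have mono: "b $ (I ! l) \<le> b $ (I ! k)" if "k \<le> l" "l < length I" for k l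
    using I(2) that by (cases "k = l") (auto simp: sorted_wrt_iff_nth_less)
  define F where "F = val (sort_loop b I 1 0 [])"
  define s where "s = sum_list (map (\<lambda>j. b $ j) F)"
  define c where "c = s / (1 + real (length F))"
  obtain k where k: "k \<le> length I" "F = rev (take k I)"
    and last: "k > 0 \<longrightarrow> c \<le> b $ (I ! (k - 1))"
    and first: "k < length I \<longrightarrow> b $ (I ! k) \<le> c"
    \<comment> \<open>Starting the round counter at 1 turns the denominator
      \<open>i + real k\<close> into one plus the size of \<open>F\<close>.\<close>
    using val_sort_loop[of 1 I b 0 "[]"]
    by (auto simp: F_def s_def c_def Let_def rev_map[symmetric])
  have dist_F: "distinct F" and sub: "set F \<subseteq> {..<d}"
    using k dist set_I set_take_subset[of k I] by auto
  have c_eq: "c = (\<Sum>j\<in>set F. b $ j) / (1 + real (card (set F)))"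
    using dist_F by (simp add: c_def s_def sum_list_distinct_conv_sum_set distinct_card)
  have above: "c \<le> b $ j" if j: "j \<in> set F" for j
  proof -
    obtain l where l: "l < k" "j = I ! l"
      using j k by (auto simp: in_set_conv_nth)
    then have "l \<le> k - 1" "k - 1 < length I" "k > 0"
      using k(1) by auto
    then show ?thesis
      using mono[of l "k - 1"] last l by auto
  qed
  have below: "b $ j \<le> c" if j: "j < d" "j \<notin> set F" for j
  proof -
    obtain l where l: "l < length I" "j = I ! l"
      using j(1) set_I by (metis in_set_conv_nth lessThan_iff)
    moreover have "k \<le> l"
      using j(2) k l by (force simp: in_set_conv_nth not_less[symmetric])
    ultimately show ?thesis
      using mono[of k l] first by auto
  qed
  \<comment> \<open>The number subtracted inside \<open>Q_inv_mult\<close> is \<open>c\<close>, so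
    negating its result gives \<open>(c - b $ j) / 2\<close>.\<close>
  have "val (sorting_algorithm tie d b) =
      val (write_entries F (map (\<lambda>j. (c - b $ j) / 2) F) (0\<^sub>v d))"
    by (simp add: sorting_algorithm_def copy_def compute_def fill_def val_map_tm Q_inv_mult_def
        val_sum_tm val_count_tm comp_def c_def s_def minus_divide_left flip: I_def F_def)
  also have "\<dots> = vec d (\<lambda>j. if j \<in> set F then (c - b $ j) / 2 else 0)"
    using dist_F sub by (subst val_write_entries) (auto intro!: eq_vecI)
  finally show ?thesis
    using optimal_solutions_threshold[OF assms sub, folded c_eq, OF above below] by simp
qed

section \<open>Running time\<close>

lemma cost_split: "cost (split xs) = 3 * length xs + 2"
  by (induction xs) (auto simp: copy_def step_def split: prod.splits)

text \<open>Each output element chosen by a comparison costs two steps, one call of \<open>r\<close>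
  and one copy, hence \<open>c + 3\<close>; the base cases cost at most 3.\<close>

lemma cost_merge:
  assumes "\<And>x y. cost (r x y) \<le> c"
  shows "cost (merge r xs ys) \<le> (c + 3) * (length xs + length ys) + 3"
  using assms
proof (induction r xs ys rule: merge.induct)
  case (3 r x xs y ys)
  have "cost (merge r xs (y # ys)) \<le> (c + 3) * (length xs + length (y # ys)) + 3"
    if "val (r x y)"
    using 3(1)[OF refl refl refl that 3(3)] .
  moreover have "cost (merge r (x # xs) ys) \<le> (c + 3) * (length (x # xs) + length ys) + 3"
    if "\<not> val (r x y)"
    using 3(2)[OF refl refl refl that 3(3)] .
  ultimately show ?case
    using 3(3)[of x y] by (auto simp: copy_def step_def algebra_simps)
qed (auto simp: copy_def step_def)

text \<open>\<open>k\<close> bounds the depth of the recursion, since halving lowers the exponent by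
  one, and \<open>c + 11\<close> bounds the work per element on each level.\<close>

lemma cost_merge_sort:
  assumes "\<And>x y. cost (r x y) \<le> c" "length xs \<le> 2 ^ k"
  shows "cost (merge_sort r xs) \<le> (c + 11) * length xs * k + 3"
  using assms
proof (induction r xs arbitrary: k rule: merge_sort.induct)
  case (3 r x y zs)
  define n where "n = length (x # y # zs)"
  obtain us vs where s: "val (split (x # y # zs)) = (us, vs)" by fastforce
  then have len: "length us = (n + 1) div 2" "length vs = n div 2"
    using length_split[of "x # y # zs"] by (simp_all del: split.simps add: n_def)
  obtain k' where k: "k = Suc k'"
    using 3(4) by (cases k) auto
  have n: "length us + length vs = n" "n \<ge> 2" "length us \<le> 2 ^ k'" "length vs \<le> 2 ^ k'"
    using 3(4) len unfolding n_def[symmetric] k by (auto simp: n_def)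
  let ?us = "val (merge_sort r us)" and ?vs = "val (merge_sort r vs)"
  have "cost (merge_sort r us) \<le> (c + 11) * length us * k' + 3"
    using 3(1)[OF refl refl s[symmetric] refl 3(3) n(3)] .
  moreover have "cost (merge_sort r vs) \<le> (c + 11) * length vs * k' + 3"
    using 3(2)[OF refl refl s[symmetric] refl refl 3(3) n(4)] .
  moreover have "cost (merge r ?us ?vs) \<le> (c + 3) * n + 3"
    using cost_merge[where r = r and xs = ?us and ys = ?vs, OF 3(3)] n(1)
      mset_merge_sort[THEN mset_eq_length]
    by metis
  moreover have "cost (merge_sort r (x # y # zs)) =
      3 * n + 4 + cost (merge_sort r us) + cost (merge_sort r vs) + cost (merge r ?us ?vs)"
    using s cost_split[of "x # y # zs"] by (simp del: split.simps add: step_def n_def)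
  ultimately have "cost (merge_sort r (x # y # zs)) \<le>
      (c + 11) * (length us + length vs) * k' + (c + 6) * n + 13"
    by (simp add: algebra_simps)
  \<comment> \<open>The 11 absorbs the constants: \<open>(c + 6) * n + 13\<close> is at most
    \<open>(c + 11) * n + 3\<close> because \<open>n \<ge> 2\<close>.\<close>
  also have "\<dots> \<le> (c + 11) * n * k + 3"
    using n(1,2) by (simp add: k algebra_simps)
  finally show ?case by (simp only: n_def)
qed (auto simp: copy_def step_def)

lemma cost_before: "cost (before tie b i j) \<le> 8"
  by (simp add: before_def copy_def compute_def)

lemma cost_map_tm:
  assumes "\<And>x. cost (f x) = c"
  shows "cost (map_tm f xs) = (c + 2) * length xs + 2"
  by (induction xs) (auto simp: assms copy_def step_def)

lemma cost_sum_tm: "cost (sum_tm xs) = 3 * length xs + 2"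
  by (induction xs) (auto simp: copy_def compute_def step_def)

lemma cost_count_tm: "cost (count_tm xs) = 3 * length xs + 2"
  by (induction xs) (auto simp: copy_def compute_def step_def)

lemma cost_sort_loop: "cost (sort_loop b js i S F) \<le> 11 * length js + 2"
proof (induction js arbitrary: i S F)
  case (Cons j js)
  show ?case
    using Cons.IH[of "i + 1" "S + b $ j" "j # F"] by (simp add: copy_def compute_def step_def)
qed (simp add: copy_def step_def)

lemma length_sort_loop: "length (val (sort_loop b js i S F)) \<le> length js + length F"
proof (induction js arbitrary: i S F)
  case (Cons j js)
  show ?case
    using Cons.IH[of "i + 1" "S + b $ j" "j # F"] by (simp add: copy_def compute_def)
qed (simp add: copy_def)

lemma cost_write_entries: "cost (write_entries js ws x) = 2 * min (length js) (length ws) + 2"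
  by (induction js ws x rule: write_entries.induct) (auto simp: copy_def step_def)

text \<open>The 19 is 8 for a comparison plus the 11 of merge sort. The 40 is 8 for the two fills,
  11 for the loop and 21 for the passes over \<open>F\<close>.\<close>

lemma cost_sorting_algorithm:
  assumes "d \<le> 2 ^ k"
  shows "cost (sorting_algorithm tie d b) \<le> 19 * d * k + 40 * d + 28"
proof -
  define I where "I = val (merge_sort (before tie b) [0..<d])"
  have len_I: "length I = d"
    using mset_merge_sort[THEN mset_eq_length, of "before tie b" "[0..<d]"] by (simp add: I_def)
  define F where "F = val (sort_loop b I 1 0 [])"
  have len_F: "length F \<le> d"
    using length_sort_loop[of b I 1 0 "[]"] len_I by (simp add: F_def)
  have "cost (merge_sort (before tie b) [0..<d]) \<le> 19 * d * k + 3"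
    using cost_merge_sort[of "before tie b" 8 "[0..<d]" k, OF cost_before] assms by simp
  moreover have "cost (sort_loop b I 1 0 []) \<le> 11 * d + 2"
    using cost_sort_loop[of b I 1 0 "[]"] len_I by simp
  ultimately show ?thesis
    using len_F
    by (simp add: sorting_algorithm_def copy_def compute_def fill_def Q_inv_mult_def val_map_tm
        cost_map_tm cost_sum_tm cost_count_tm cost_write_entries flip: I_def F_def)
qed

text \<open>Rounding the logarithm up adds at most 1, which is at most the logarithm itself for
  \<open>d \<ge> 2\<close>.\<close>

lemma exists_power_of_two:
  assumes "d \<ge> 2"
  shows "\<exists>k. d \<le> 2 ^ k \<and> real k \<le> 2 * log 2 (real d)"
proof (intro exI conjI)
  let ?k = "nat \<lceil>log 2 (real d)\<rceil>"
  have log: "1 \<le> log 2 (real d)"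
    using assms by simp
  then show "real ?k \<le> 2 * log 2 (real d)"
    by linarith
  have "real d = 2 powr log 2 (real d)"
    using assms by simp
  also have "\<dots> \<le> 2 powr real ?k"
    by (intro powr_mono) linarith+
  finally show "d \<le> 2 ^ ?k"
    by (simp add: powr_realpow flip: of_nat_le_iff)
qed

text \<open>Quantifying over \<open>tie\<close> covers every sorting permutation the algorithm may
  choose, by \<open>ex_tie\<close>.\<close>

theorem corollary3p12:
  shows "\<exists>C::real. C > 0 \<and>
    (\<forall>d\<ge>2. \<forall>b\<in>carrier_vec d. \<forall>tie.
       optimal_solutions d b = {val (sorting_algorithm tie d b)} \<and>
       real (cost (sorting_algorithm tie d b)) \<le> C * real d * ln (real d))"
proof (intro exI[of _ "92 / ln 2"] conjI allI impI ballI)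
  fix d :: nat and b :: "real vec" and tie
  assume d: "2 \<le> d" and b: "b \<in> carrier_vec d"
  show "optimal_solutions d b = {val (sorting_algorithm tie d b)}"
    using val_sorting_algorithm[OF b] .
  obtain k where k: "d \<le> 2 ^ k" "real k \<le> 2 * log 2 (real d)"
    using exists_power_of_two[OF d] by blast
  have log: "1 \<le> log 2 (real d)"
    using d by simp
  have "real (cost (sorting_algorithm tie d b)) \<le> real (19 * d * k + 40 * d + 28)"
    using cost_sorting_algorithm[OF k(1), of tie b] by (simp only: of_nat_le_iff)
  \<comment> \<open>Here \<open>28 \<le> 14 * d\<close>, and 40 + 14 = 54.\<close>
  also have "\<dots> \<le> real d * (19 * real k + 54)"
    using d by (simp add: algebra_simps)
  \<comment> \<open>92 = 2 * 19 + 54, the 54 being multiplied by a logarithm that is at least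
    1.\<close>
  also have "\<dots> \<le> real d * (92 * log 2 (real d))"
    using k(2) log by (intro mult_left_mono) auto
  finally show "real (cost (sorting_algorithm tie d b)) \<le> 92 / ln 2 * real d * ln (real d)"
    by (simp add: log_def mult_ac)
qed simp

end
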